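(* Let $\varphi$ be an untranscendable order type that is equimorphic to an order type having only finitely many finite $F$-classes. Then $\varphi$ is strongly indecomposable or $\varphi = 2$.
   Context: Work in ZFC. Order types are isomorphism classes of linear orders; $\varphi\leqslant\psi$ means an order of type $\varphi$ embeds in one of type $\psi$; $\varphi<\psi$ means $\varphi\leqslant\psi$ and not $\psi\leqslant\varphi$; $\varphi,\psi$ are equimorphic if $\varphi\leqslant\psi$ and $\psi\leqslant\varphi$. For linear orders $Y,X$, the product $YX$ is $Y\times X$ ordered anti-lexicographically ($(y,x)<(y',x')$ iff $x<x'$, or $x=x'$ and $y<y'$); $\psi\tau$ denotes the type of such a product. A type $\varphi$ is untranscendable if there are no types $\psi<\varphi$, $\tau<\varphi$ with $\varphi\leqslant\psi\tau$. A linear order $X$ (or its type) is strongly indecomposable if for every partition $X=A\cup B$ into two suborders, $X$ embeds into $A$ or into $B$. For a linear order $X$, the finite condensation $F$ is the equivalence relation $xFx'$ iff the closed interval between $x$ and $x'$ is finite; its equivalence classes are the $F$-classes. A type has only finitely many finite $F$-classes if some (any) representative does. *)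

theory Defs
  imports Main
begin

text \<open>
  Order types are handled through representatives: a linear order is a reflexive relation \<open>r\<close> with
  \<open>Linear_order r\<close> and underlying set \<open>Field r\<close>. All notions below are invariant under isomorphism,
  so they are notions about order types, and equality of types is \<open>order_isomorphic\<close>.
\<close>

definition order_embeds :: "'a rel \<Rightarrow> 'b rel \<Rightarrow> bool" where
  "order_embeds r s \<longleftrightarrow>
    (\<exists>f. inj_on f (Field r) \<and> f ` Field r \<subseteq> Field s \<and>
         (\<forall>x\<in>Field r. \<forall>y\<in>Field r. (x, y) \<in> r \<longleftrightarrow> (f x, f y) \<in> s))"

definition order_isomorphic :: "'a rel \<Rightarrow> 'b rel \<Rightarrow> bool" where
  "order_isomorphic r s \<longleftrightarrow>
    (\<exists>f. bij_betw f (Field r) (Field s) \<and>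
         (\<forall>x\<in>Field r. \<forall>y\<in>Field r. (x, y) \<in> r \<longleftrightarrow> (f x, f y) \<in> s))"

definition strictly_embeds :: "'a rel \<Rightarrow> 'b rel \<Rightarrow> bool" where
  "strictly_embeds r s \<longleftrightarrow> order_embeds r s \<and> \<not> order_embeds s r"

definition equimorphic :: "'a rel \<Rightarrow> 'b rel \<Rightarrow> bool" where
  "equimorphic r s \<longleftrightarrow> order_embeds r s \<and> order_embeds s r"

text \<open>The product is anti-lexicographic: the second coordinate is compared first.\<close>

definition antilex_prod :: "'a rel \<Rightarrow> 'b rel \<Rightarrow> ('a \<times> 'b) rel" where
  "antilex_prod s t =
    {((y, x), (y', x')). y \<in> Field s \<and> y' \<in> Field s \<and> x \<in> Field t \<and> x' \<in> Field t \<and>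
       (x \<noteq> x' \<and> (x, x') \<in> t \<or> x = x' \<and> (y, y') \<in> s)}"

text \<open>
  The factors range over linear orders on the same HOL type as \<open>r\<close>. This is no restriction: an order
  strictly below \<open>r\<close> embeds in \<open>r\<close>, hence has an isomorphic copy inside \<open>Field r\<close>
  (see \<open>untranscendable_any_type\<close>).
\<close>

definition untranscendable :: "'a rel \<Rightarrow> bool" where
  "untranscendable r \<longleftrightarrow>
    \<not> (\<exists>(s :: 'a rel) (t :: 'a rel). Linear_order s \<and> Linear_order t \<and>
         strictly_embeds s r \<and> strictly_embeds t r \<and> order_embeds r (antilex_prod s t))"

definition strongly_indecomposable :: "'a rel \<Rightarrow> bool" where
  "strongly_indecomposable r \<longleftrightarrow>
    (\<forall>A B. A \<union> B = Field r \<and> A \<inter> B = {} \<longrightarrow>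
       order_embeds r (Restr r A) \<or> order_embeds r (Restr r B))"

text \<open>At most one of the two sets in the union contains more than one point.\<close>

definition between :: "'a rel \<Rightarrow> 'a \<Rightarrow> 'a \<Rightarrow> 'a set" where
  "between r x x' = {z. (x, z) \<in> r \<and> (z, x') \<in> r} \<union> {z. (x', z) \<in> r \<and> (z, x) \<in> r}"

definition finite_condensation :: "'a rel \<Rightarrow> 'a rel" where
  "finite_condensation r = {(x, x'). x \<in> Field r \<and> x' \<in> Field r \<and> finite (between r x x')}"

definition F_classes :: "'a rel \<Rightarrow> 'a set set" where
  "F_classes r = Field r // finite_condensation r"

definition finitely_many_finite_F_classes :: "'a rel \<Rightarrow> bool" where
  "finitely_many_finite_F_classes r \<longleftrightarrow> finite {C \<in> F_classes r. finite C}"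

lemma order_embedsE:
  assumes "order_embeds r s"
  obtains f where "inj_on f (Field r)" "f ` Field r \<subseteq> Field s"
    "\<And>x y. x \<in> Field r \<Longrightarrow> y \<in> Field r \<Longrightarrow> (x, y) \<in> r \<longleftrightarrow> (f x, f y) \<in> s"
  using assms unfolding order_embeds_def by auto

lemma order_embeds_trans:
  assumes "order_embeds r s" "order_embeds s t"
  shows "order_embeds r t"
proof -
  obtain f where f: "inj_on f (Field r)" "f ` Field r \<subseteq> Field s"
    "\<And>x y. x \<in> Field r \<Longrightarrow> y \<in> Field r \<Longrightarrow> (x, y) \<in> r \<longleftrightarrow> (f x, f y) \<in> s"
    using order_embedsE[OF assms(1)] by metis
  obtain g where g: "inj_on g (Field s)" "g ` Field s \<subseteq> Field t"
    "\<And>x y. x \<in> Field s \<Longrightarrow> y \<in> Field s \<Longrightarrow> (x, y) \<in> s \<longleftrightarrow> (g x, g y) \<in> t"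
    using order_embedsE[OF assms(2)] by metis
  have "inj_on (g \<circ> f) (Field r)"
    using f(1,2) g(1) by (meson comp_inj_on inj_on_subset)
  moreover have "(g \<circ> f) ` Field r \<subseteq> Field t" using f(2) g(2) by auto
  moreover have "\<forall>x\<in>Field r. \<forall>y\<in>Field r. (x, y) \<in> r \<longleftrightarrow> ((g \<circ> f) x, (g \<circ> f) y) \<in> t"
    using f(2,3) g(3) by (simp add: image_subset_iff)
  ultimately show ?thesis unfolding order_embeds_def by blast
qed

lemma antilex_prod_subset:
  "antilex_prod s t \<subseteq> (Field s \<times> Field t) \<times> (Field s \<times> Field t)"
  unfolding antilex_prod_def by auto

lemma Field_antilex_prod_subset: "Field (antilex_prod s t) \<subseteq> Field s \<times> Field t"
  using antilex_prod_subset[of s t] unfolding Field_def[of "antilex_prod s t"] by blast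

lemma Field_antilex_prod:
  assumes "Linear_order s" "Linear_order t"
  shows "Field (antilex_prod s t) = Field s \<times> Field t"
proof
  show "Field (antilex_prod s t) \<subseteq> Field s \<times> Field t"
    by (rule Field_antilex_prod_subset)
  show "Field s \<times> Field t \<subseteq> Field (antilex_prod s t)"
  proof
    fix p assume "p \<in> Field s \<times> Field t"
    then have "(p, p) \<in> antilex_prod s t"
      using assms by (auto simp: antilex_prod_def order_on_defs refl_on_def)
    then show "p \<in> Field (antilex_prod s t)" by (rule FieldI1)
  qed
qed

lemma Linear_order_antilex_prod:
  assumes "Linear_order s" "Linear_order t"
  shows "Linear_order (antilex_prod s t)"
proof -
  have s: "refl_on (Field s) s" "trans s" "antisym s" "total_on (Field s) s"
    and t: "refl_on (Field t) t" "trans t" "antisym t" "total_on (Field t) t"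
    using assms unfolding order_on_defs by auto
  have "refl_on (Field s \<times> Field t) (antilex_prod s t)"
    using s(1) t(1) by (auto simp: antilex_prod_def refl_on_def)
  moreover have "trans (antilex_prod s t)"
  proof (rule transI)
    fix p q u assume "(p, q) \<in> antilex_prod s t" "(q, u) \<in> antilex_prod s t"
    then show "(p, u) \<in> antilex_prod s t"
      by (auto simp: antilex_prod_def dest: transD[OF s(2)] transD[OF t(2)] antisymD[OF t(3)])
  qed
  moreover have "antisym (antilex_prod s t)"
    using s(3) t(3) by (auto simp: antilex_prod_def antisym_def)
  moreover have "total_on (Field s \<times> Field t) (antilex_prod s t)"
    using s(4) t(4) by (auto simp: antilex_prod_def total_on_def)
  ultimately show ?thesis
    using Field_antilex_prod[OF assms] antilex_prod_subset[of s t] unfolding order_on_defs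
    by simp
qed

lemma order_embeds_copy:
  assumes s: "Linear_order (s :: 'b rel)" and emb: "order_embeds s (r :: 'a rel)"
  obtains s' :: "'a rel" where "Linear_order s'" "order_embeds s s'" "order_embeds s' s"
proof -
  obtain f :: "'b \<Rightarrow> 'a" where f: "inj_on f (Field s)"
    using emb unfolding order_embeds_def by blast
  define s' where "s' = map_prod f f ` s"
  have F: "Field s' = f ` Field s" unfolding s'_def Field_def by force
  have iff: "(f x, f y) \<in> s' \<longleftrightarrow> (x, y) \<in> s" if "x \<in> Field s" "y \<in> Field s" for x y
  proof
    assume "(f x, f y) \<in> s'"
    then obtain a b where "(a, b) \<in> s" "f x = f a" "f y = f b" unfolding s'_def by auto
    then show "(x, y) \<in> s" using inj_onD[OF f] that by (metis FieldI1 FieldI2)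
  qed (auto simp: s'_def)
  have d: "refl_on (Field s) s" "trans s" "antisym s" "total_on (Field s) s"
    using s unfolding order_on_defs by auto
  have mem: "\<exists>a b. a \<in> Field s \<and> b \<in> Field s \<and> p = f a \<and> q = f b" if "(p, q) \<in> s'" for p q
    using that unfolding s'_def by (auto intro: FieldI1 FieldI2)
  have "refl_on (Field s') s'"
    unfolding refl_on_def F using iff d(1) by (auto simp: refl_on_def)
  moreover have "trans s'"
  proof (rule transI)
    fix p q u assume a: "(p, q) \<in> s'" "(q, u) \<in> s'"
    obtain x y where xy: "x \<in> Field s" "y \<in> Field s" "p = f x" "q = f y" using mem[OF a(1)] by blast
    obtain z where z: "z \<in> Field s" "u = f z" using mem[OF a(2)] by blast
    show "(p, u) \<in> s'" using a xy z iff transD[OF d(2)] by metis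
  qed
  moreover have "antisym s'"
  proof (rule antisymI)
    fix p q assume a: "(p, q) \<in> s'" "(q, p) \<in> s'"
    obtain x y where xy: "x \<in> Field s" "y \<in> Field s" "p = f x" "q = f y" using mem[OF a(1)] by blast
    show "p = q" using a xy iff antisymD[OF d(3)] by metis
  qed
  moreover have "total_on (Field s') s'"
    unfolding total_on_def F using iff d(4) by (auto simp: total_on_def)
  ultimately have L: "Linear_order s'"
    unfolding order_on_defs by (auto simp: Field_def)
  have e1: "order_embeds s s'"
    unfolding order_embeds_def using f F iff by (intro exI[of _ f]) auto
  have e2: "order_embeds s' s"
    unfolding order_embeds_def
  proof (intro exI[of _ "inv_into (Field s) f"] conjI ballI)
    show "inj_on (inv_into (Field s) f) (Field s')" unfolding F by (rule inj_on_inv_into) simp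
    show "inv_into (Field s) f ` Field s' \<subseteq> Field s" unfolding F by (auto intro: inv_into_into)
    fix p q assume "p \<in> Field s'" "q \<in> Field s'"
    then obtain x y where "x \<in> Field s" "y \<in> Field s" "p = f x" "q = f y" unfolding F by blast
    then show "(p, q) \<in> s' \<longleftrightarrow> (inv_into (Field s) f p, inv_into (Field s) f q) \<in> s"
      using iff f by simp
  qed
  show thesis using that L e1 e2 by blast
qed

lemma antilex_prod_mono:
  assumes "order_embeds s s'" "order_embeds t t'"
  shows "order_embeds (antilex_prod s t) (antilex_prod s' t')"
proof -
  obtain f where f: "inj_on f (Field s)" "f ` Field s \<subseteq> Field s'"
    "\<And>x y. x \<in> Field s \<Longrightarrow> y \<in> Field s \<Longrightarrow> (x, y) \<in> s \<longleftrightarrow> (f x, f y) \<in> s'"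
    using order_embedsE[OF assms(1)] by metis
  obtain g where g: "inj_on g (Field t)" "g ` Field t \<subseteq> Field t'"
    "\<And>x y. x \<in> Field t \<Longrightarrow> y \<in> Field t \<Longrightarrow> (x, y) \<in> t \<longleftrightarrow> (g x, g y) \<in> t'"
    using order_embedsE[OF assms(2)] by metis
  have sub: "Field (antilex_prod s t) \<subseteq> Field s \<times> Field t"
    by (rule Field_antilex_prod_subset)
  have iff: "(p, q) \<in> antilex_prod s t \<longleftrightarrow>
      (map_prod f g p, map_prod f g q) \<in> antilex_prod s' t'"
    if carrier: "p \<in> Field s \<times> Field t" "q \<in> Field s \<times> Field t" for p q
  proof -
    obtain y x y' x' where pq: "p = (y, x)" "q = (y', x')"
      and y: "y \<in> Field s" "y' \<in> Field s" and x: "x \<in> Field t" "x' \<in> Field t"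
      using carrier by blast
    have "f y \<in> Field s'" "f y' \<in> Field s'" "g x \<in> Field t'" "g x' \<in> Field t'"
      using f(2) g(2) y x by blast+
    then show ?thesis
      using y x f(3)[OF y] g(3)[OF x] inj_on_eq_iff[OF g(1) x]
      unfolding pq antilex_prod_def by simp
  qed
  have inj: "inj_on (map_prod f g) (Field s \<times> Field t)"
    using f(1) g(1) by (rule map_prod_inj_on)
  have img: "map_prod f g ` Field (antilex_prod s t) \<subseteq> Field (antilex_prod s' t')"
  proof (rule image_subsetI)
    fix p assume "p \<in> Field (antilex_prod s t)"
    then have "p \<in> Domain (antilex_prod s t) \<or> p \<in> Range (antilex_prod s t)"
      unfolding Field_def by (rule UnE) simp_all
    then obtain q where q: "(p, q) \<in> antilex_prod s t \<or> (q, p) \<in> antilex_prod s t"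
      unfolding Domain_iff Range_iff by metis
    then have "p \<in> Field s \<times> Field t" "q \<in> Field s \<times> Field t"
      by (metis antilex_prod_subset mem_Sigma_iff subsetD)+
    with q have "(map_prod f g p, map_prod f g q) \<in> antilex_prod s' t' \<or>
        (map_prod f g q, map_prod f g p) \<in> antilex_prod s' t'"
      using iff[of p q] iff[of q p] by metis
    then show "map_prod f g p \<in> Field (antilex_prod s' t')"
      by (metis FieldI1 FieldI2)
  qed
  show ?thesis
    unfolding order_embeds_def
  proof (intro exI[of _ "map_prod f g"] conjI ballI)
    show "inj_on (map_prod f g) (Field (antilex_prod s t))" using inj sub by (rule inj_on_subset)
    show "map_prod f g ` Field (antilex_prod s t) \<subseteq> Field (antilex_prod s' t')" by (rule img)
    fix p q assume "p \<in> Field (antilex_prod s t)" "q \<in> Field (antilex_prod s t)"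
    then show "(p, q) \<in> antilex_prod s t \<longleftrightarrow>
        (map_prod f g p, map_prod f g q) \<in> antilex_prod s' t'"
      by (intro iff) (use sub in \<open>auto dest: subsetD\<close>)
  qed
qed

lemma untranscendable_any_type:
  fixes r :: "'a rel" and s :: "'b rel" and t :: "'c rel"
  assumes "untranscendable r" "Linear_order s" "Linear_order t"
    and "strictly_embeds s r" "strictly_embeds t r"
  shows "\<not> order_embeds r (antilex_prod s t)"
proof
  assume e: "order_embeds r (antilex_prod s t)"
  obtain s' :: "'a rel" where s': "Linear_order s'" "order_embeds s s'" "order_embeds s' s"
    using order_embeds_copy assms(2,4) unfolding strictly_embeds_def by blast
  obtain t' :: "'a rel" where t': "Linear_order t'" "order_embeds t t'" "order_embeds t' t"
    using order_embeds_copy assms(3,5) unfolding strictly_embeds_def by blast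
  have "strictly_embeds s' r" "strictly_embeds t' r"
    using assms(4,5) s' t' unfolding strictly_embeds_def by (meson order_embeds_trans)+
  moreover have "order_embeds r (antilex_prod s' t')"
    using e antilex_prod_mono[OF s'(2) t'(2)] by (rule order_embeds_trans)
  ultimately show False using assms(1) s'(1) t'(1) unfolding untranscendable_def by blast
qed

end

theory Submission imports Defs begin

text \<open>
  Let \<open>s\<close> be an infinite untranscendable order and \<open>Field s = A \<union> B\<close> with \<open>s\<close> not embeddable in \<open>A\<close>.
  Collapsing the convex components of \<open>A\<close> writes \<open>s\<close> as a suborder of \<open>A \<times> s/\<sim>\<close>, so \<open>s\<close> embeds in \<open>s/\<sim>\<close>;
  that is, \<open>s\<close> has a self-embedding \<open>g\<close> with a point of \<open>B\<close> in every \<open>[g x, g y]\<close>, \<open>x < y\<close>.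
  If \<open>B\<close> is finite this is absurd, so \<open>s\<close> embeds in the complement \<open>Y\<close> of its finite \<open>F\<close>-classes,
  where every point \<open>y\<close> belongs to a pair \<open>l < h\<close> of consecutive points. Sending \<open>y\<close> to a point \<open>b\<close> of \<open>B\<close> in
  \<open>[g l, g h]\<close> is monotone, and a fibre has at most three points, one for each of \<open>g y < b\<close>, \<open>g y = b\<close>,
  \<open>g y > b\<close>. So \<open>s\<close> embeds in \<open>3 \<times> B\<close>, hence, being untranscendable, in \<open>B\<close>.
\<close>

section \<open>Linear orders and strictly monotone maps\<close>

lemma Linear_orderD:
  assumes "Linear_order r"
  shows "Refl r" "\<And>x. x \<in> Field r \<Longrightarrow> (x, x) \<in> r"
    "\<And>x y z. (x, y) \<in> r \<Longrightarrow> (y, z) \<in> r \<Longrightarrow> (x, z) \<in> r"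
    "\<And>x y. (x, y) \<in> r \<Longrightarrow> (y, x) \<in> r \<Longrightarrow> x = y"
    "\<And>x y. x \<in> Field r \<Longrightarrow> y \<in> Field r \<Longrightarrow> (x, y) \<in> r \<or> (y, x) \<in> r"
  using assms unfolding order_on_defs refl_on_def total_on_def
  by (auto dest: antisymD transD) metis

lemma Field_Restr_Linear_order:
  "Linear_order r \<Longrightarrow> A \<subseteq> Field r \<Longrightarrow> Field (Restr r A) = A"
  using Refl_Field_Restr[of r A] by (auto dest: Linear_orderD(1))

lemma linear_order_on_Restr:
  "Linear_order r \<Longrightarrow> A \<subseteq> Field r \<Longrightarrow> linear_order_on A (Restr r A)"
  using Linear_order_Restr[of r A] by (simp add: Field_Restr_Linear_order)

lemma order_embeds_strict_monoI:
  assumes r: "Linear_order r" and s: "Linear_order s"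
    and f: "\<And>x. x \<in> Field r \<Longrightarrow> f x \<in> Field s"
    and m: "\<And>x y. (x, y) \<in> r \<Longrightarrow> x \<noteq> y \<Longrightarrow> (f x, f y) \<in> s \<and> f x \<noteq> f y"
  shows "order_embeds r s"
  unfolding order_embeds_def
proof (intro exI[of _ f] conjI ballI)
  show inj: "inj_on f (Field r)"
    by (rule inj_onI) (metis m Linear_orderD(5)[OF r])
  show "f ` Field r \<subseteq> Field s" using f by blast
  fix x y assume "x \<in> Field r" "y \<in> Field r"
  then show "(x, y) \<in> r \<longleftrightarrow> (f x, f y) \<in> s"
    by (metis m f Linear_orderD(2,5)[OF r] Linear_orderD(2,4)[OF s])
qed

lemma order_embedsE_strict_mono:
  assumes "order_embeds r s"
  obtains f where "\<forall>x\<in>Field r. f x \<in> Field s"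
    "\<forall>x y. (x, y) \<in> r \<longrightarrow> (f x, f y) \<in> s"
    "\<forall>x y. (x, y) \<in> r \<longrightarrow> x \<noteq> y \<longrightarrow> f x \<noteq> f y"
proof -
  obtain f where f: "inj_on f (Field r)" "f ` Field r \<subseteq> Field s"
    "\<And>x y. x \<in> Field r \<Longrightarrow> y \<in> Field r \<Longrightarrow> (x, y) \<in> r \<longleftrightarrow> (f x, f y) \<in> s"
    using order_embedsE[OF assms] by metis
  have "f x \<noteq> f y" if "(x, y) \<in> r" "x \<noteq> y" for x y
    using inj_onD[OF f(1), of x y] that by (auto intro: FieldI1 FieldI2)
  then show thesis
    using that[of f] f(2,3) by (metis FieldI1 FieldI2 image_subset_iff)
qed

lemma order_embeds_Restr:
  assumes "Linear_order r" "A \<subseteq> Field r"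
  shows "order_embeds (Restr r A) r"
  by (rule order_embeds_strict_monoI[where f = "\<lambda>x. x"])
    (use assms in \<open>auto simp: linear_order_on_Restr Field_Restr_Linear_order\<close>)

lemma order_embeds_finite:
  "order_embeds r s \<Longrightarrow> finite (Field s) \<Longrightarrow> finite (Field r)"
  unfolding order_embeds_def by (metis finite_imageD finite_subset)

text \<open>The map \<open>x\<close> to \<open>(h (c x) x, c x)\<close>: the second coordinate
  decides between different fibres of the monotone map \<open>c\<close>, the first one within a
  fibre. Each fibre may be embedded in \<open>p\<close> on its own, without any compatibility, so
  \<open>h\<close> is chosen separately for each \<open>v\<close>.\<close>

lemma order_embeds_antilex_prod:
  assumes r: "Linear_order r" and p: "Linear_order p" and t: "Linear_order t"
    and c: "\<And>x. x \<in> Field r \<Longrightarrow> c x \<in> Field t"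
    and m: "\<And>x y. (x, y) \<in> r \<Longrightarrow> (c x, c y) \<in> t"
    and fib: "\<And>v. v \<in> Field t \<Longrightarrow> \<exists>h. (\<forall>x\<in>Field r. c x = v \<longrightarrow> h x \<in> Field p) \<and>
      (\<forall>x y. (x, y) \<in> r \<longrightarrow> x \<noteq> y \<longrightarrow> c x = v \<longrightarrow> c y = v \<longrightarrow> (h x, h y) \<in> p \<and> h x \<noteq> h y)"
  shows "order_embeds r (antilex_prod p t)"
proof -
  obtain h where h: "\<And>v x. v \<in> Field t \<Longrightarrow> x \<in> Field r \<Longrightarrow> c x = v \<Longrightarrow> h v x \<in> Field p"
    "\<And>v x y. v \<in> Field t \<Longrightarrow> (x, y) \<in> r \<Longrightarrow> x \<noteq> y \<Longrightarrow> c x = v \<Longrightarrow> c y = v \<Longrightarrow>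
       (h v x, h v y) \<in> p \<and> h v x \<noteq> h v y"
    using fib by metis
  show ?thesis
  proof (rule order_embeds_strict_monoI[where f = "\<lambda>x. (h (c x) x, c x)"])
    show "(h (c x) x, c x) \<in> Field (antilex_prod p t)" if "x \<in> Field r" for x
      using that c h(1) by (simp add: Field_antilex_prod[OF p t])
    fix x y assume xy: "(x, y) \<in> r" "x \<noteq> y"
    then have F: "x \<in> Field r" "y \<in> Field r" by (auto intro: FieldI1 FieldI2)
    show "((h (c x) x, c x), (h (c y) y, c y)) \<in> antilex_prod p t \<and>
        (h (c x) x, c x) \<noteq> (h (c y) y, c y)"
      using m[OF xy(1)] h(1)[OF c] h(2)[OF c xy] F xy c
      by (cases "c x = c y") (auto simp: antilex_prod_def)
  qed (use r p t Linear_order_antilex_prod in auto)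
qed

section \<open>Intervals\<close>

lemma between_self_mem:
  assumes "Linear_order r" "x \<in> Field r" "y \<in> Field r"
  shows "x \<in> between r x y" "y \<in> between r x y"
  using assms Linear_orderD(2,5)[OF assms(1)] unfolding between_def by auto

lemma between_commute: "between r x y = between r y x"
  unfolding between_def by auto

text \<open>A triangle inequality for intervals. It makes both relations used below transitive:
  lying in the same convex component of \<open>A\<close>, and finite condensation.\<close>

lemma between_subset_Un:
  assumes r: "Linear_order r" and "y \<in> Field r"
  shows "between r x z \<subseteq> between r x y \<union> between r y z"
proof
  fix w assume "w \<in> between r x z"
  then have w: "w \<in> Field r" "(x, w) \<in> r \<and> (w, z) \<in> r \<or> (z, w) \<in> r \<and> (w, x) \<in> r"
    unfolding between_def by (auto intro: FieldI1 FieldI2)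
  then have "(w, y) \<in> r \<or> (y, w) \<in> r" using Linear_orderD(5)[OF r] assms(2) by blast
  then show "w \<in> between r x y \<union> between r y z"
    using w(2) unfolding between_def by auto
qed

section \<open>Separated self-embeddings of untranscendable orders\<close>

text \<open>The quotient by the convex components of \<open>A\<close> is realised inside
  \<open>r\<close> by a set \<open>T\<close> of representatives. As \<open>r\<close> embeds in the
  product of \<open>A\<close> and \<open>T\<close>, and \<open>A\<close> is strictly below
  \<open>r\<close>, the order \<open>T\<close> cannot be strictly below \<open>r\<close>; the
  embedding of \<open>r\<close> into \<open>T\<close> is \<open>g\<close>.\<close>

lemma untranscendable_separated_self_embedding:
  assumes r: "Linear_order r" and u: "untranscendable r" and A: "A \<subseteq> Field r"
    and n: "\<not> order_embeds r (Restr r A)"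
  obtains g where "\<forall>x\<in>Field r. g x \<in> Field r"
    "\<forall>x y. (x, y) \<in> r \<longrightarrow> (g x, g y) \<in> r"
    "\<forall>x y. (x, y) \<in> r \<longrightarrow> x \<noteq> y \<longrightarrow> g x \<noteq> g y"
    "\<forall>x y. (x, y) \<in> r \<longrightarrow> x \<noteq> y \<longrightarrow> (\<exists>b\<in>Field r - A. (g x, b) \<in> r \<and> (b, g y) \<in> r)"
proof (cases "A = {}")
  case True
  show thesis
    by (rule that[of "\<lambda>x. x"]) (use True Linear_orderD(2)[OF r] in \<open>auto dest: FieldI1 FieldI2\<close>)
next
  case False
  then obtain a where a: "a \<in> A" by blast
  note R = Linear_orderD[OF r]
  \<comment> \<open>For \<open>x\<close> in \<open>A\<close>, \<open>comp x\<close> is the convex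
    component of \<open>A\<close> around \<open>x\<close>. The representative \<open>c x\<close>
    depends on the set \<open>comp x\<close> only, hence is constant on a component; points outside
    \<open>A\<close> represent themselves.\<close>
  define comp where "comp x = {y \<in> Field r. between r x y \<subseteq> A}" for x
  define c where "c x = (if x \<in> A then SOME y. y \<in> comp x else x)" for x
  have comp_self: "x \<in> comp x" if "x \<in> A" for x
  proof -
    have "between r x x \<subseteq> {x}" unfolding between_def using R(4) by auto
    then show ?thesis unfolding comp_def using that A by auto
  qed
  have c_comp: "c x \<in> comp x" if "x \<in> A" for x
    using someI[of "\<lambda>y. y \<in> comp x", OF comp_self[OF that]] that unfolding c_def by simp
  have cF: "c x \<in> Field r" if "x \<in> Field r" for x
    using that c_comp[of x] unfolding comp_def by (cases "x \<in> A") (auto simp: c_def)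
  have compA: "y \<in> A" if "x \<in> Field r" "y \<in> comp x" for x y
    using that between_self_mem[OF r] unfolding comp_def by blast
  have comp_sub: "comp x \<subseteq> comp y" if "x \<in> Field r" "y \<in> comp x" for x y
    using that between_subset_Un[OF r that(1), of y] between_commute[of r x y]
    unfolding comp_def by blast
  have comp_sym: "x \<in> comp y" if "x \<in> Field r" "y \<in> comp x" for x y
    using that unfolding comp_def by (auto simp: between_commute)
  have comp_eq: "comp x = comp y" if "x \<in> Field r" "y \<in> comp x" for x y
    using comp_sub comp_sym that unfolding comp_def by blast
  have c_eq: "c x = c y" if "x \<in> Field r" "x \<in> A" "y \<in> comp x" for x y
    using comp_eq[OF that(1,3)] compA[OF that(1,3)] that(2) unfolding c_def by simp
  have c_mem: "c x \<in> A \<longleftrightarrow> x \<in> A" for x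
    using c_comp[of x] compA[of x "c x"] A by (auto simp: c_def)
  have idem: "c (c x) = c x" for x
    using c_eq[of x "c x"] c_comp[of x] A by (cases "x \<in> A") (auto simp: c_def)
  \<comment> \<open>Suppose \<open>c y\<close> is strictly below \<open>c x\<close>. Then
    \<open>x\<close> and \<open>y\<close> lie in \<open>A\<close>, and \<open>[x, y]\<close> is
    covered by the intervals from \<open>x\<close> to \<open>c x\<close> and from \<open>y\<close>
    to \<open>c y\<close>. So \<open>x\<close> and \<open>y\<close> share a component and
    \<open>c x = c y\<close>.\<close>
  have mono: "(c x, c y) \<in> r" if xy: "(x, y) \<in> r" for x y
  proof (rule ccontr)
    assume no: "(c x, c y) \<notin> r"
    have F: "x \<in> Field r" "y \<in> Field r" using xy by (auto intro: FieldI1 FieldI2)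
    then have yx: "(c y, c x) \<in> r" using R(5) cF no by blast
    have bx: "between r x (c x) \<subseteq> A" if "x \<in> A" for x
      using c_comp[OF that] unfolding comp_def by simp
    have "x \<in> A"
    proof (rule ccontr)
      assume x: "x \<notin> A"
      then have "c x = x" by (simp add: c_def)
      then have "y \<in> A" using no xy by (cases "y \<in> A") (auto simp: c_def)
      moreover have "x \<in> between r y (c y)" unfolding between_def using xy yx \<open>c x = x\<close> by auto
      ultimately show False using bx x by blast
    qed
    moreover have "y \<in> A"
    proof (rule ccontr)
      assume y: "y \<notin> A"
      then have "c y = y" by (simp add: c_def)
      then have "y \<in> between r x (c x)" unfolding between_def using xy yx by auto
      then show False using bx \<open>x \<in> A\<close> y by blast
    qed
    moreover have "between r x y \<subseteq> between r x (c x) \<union> between r y (c y)"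
    proof
      fix z assume "z \<in> between r x y"
      then have z: "(x, z) \<in> r" "(z, y) \<in> r" unfolding between_def using R(3,4) xy by blast+
      then have "(z, c x) \<in> r \<or> (c x, z) \<in> r" using R(5) cF F by (meson FieldI2)
      then show "z \<in> between r x (c x) \<union> between r y (c y)"
        unfolding between_def using z yx R(3) by blast
    qed
    ultimately have "y \<in> comp x" using bx F unfolding comp_def by blast
    then show False using c_eq[OF F(1) \<open>x \<in> A\<close>] no R(2) cF F by metis
  qed
  define T where "T = c ` Field r"
  have T: "T \<subseteq> Field r" unfolding T_def using cF by blast
  have LA: "Linear_order (Restr r A)" and LT: "Linear_order (Restr r T)"
    using r Linear_order_Restr by blast+
  have FA: "Field (Restr r A) = A" and FT: "Field (Restr r T) = T"
    using Field_Restr_Linear_order[OF r] A T by blast+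
  have prod: "order_embeds r (antilex_prod (Restr r A) (Restr r T))"
  proof (rule order_embeds_antilex_prod[where c = c, OF r LA LT])
    show "(c x, c y) \<in> Restr r T" if "(x, y) \<in> r" for x y
    proof -
      have "c x \<in> T" "c y \<in> T" using that unfolding T_def by (blast intro: FieldI1 FieldI2)+
      then show ?thesis using mono[OF that] by blast
    qed
    fix v
    show "\<exists>h. (\<forall>x\<in>Field r. c x = v \<longrightarrow> h x \<in> Field (Restr r A)) \<and>
      (\<forall>x y. (x, y) \<in> r \<longrightarrow> x \<noteq> y \<longrightarrow> c x = v \<longrightarrow> c y = v \<longrightarrow> (h x, h y) \<in> Restr r A \<and> h x \<noteq> h y)"
    \<comment> \<open>A fibre over a point of \<open>A\<close> lies within \<open>A\<close>, so the
      identity embeds it. Any other fibre has at most the point \<open>v\<close>, and the constant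
      \<open>a\<close> will do.\<close>
    proof (cases "v \<in> A")
      case True
      then have xA: "x \<in> A" if "c x = v" for x using c_mem[of x] that by metis
      show ?thesis unfolding FA by (intro exI[of _ "\<lambda>x. x"] conjI ballI allI impI) (use xA in blast)+
    next
      case False
      have xv: "x = v" if "c x = v" for x
      proof -
        have "x \<notin> A" using c_mem[of x] that False by metis
        then show ?thesis using that by (simp add: c_def)
      qed
      show ?thesis unfolding FA
        by (intro exI[of _ "\<lambda>x. a"] conjI ballI allI impI) (use a xv in metis)+
    qed
  qed (simp only: FT, simp add: T_def)
  have "strictly_embeds (Restr r A) r"
    unfolding strictly_embeds_def using n order_embeds_Restr[OF r A] by blast
  then have "\<not> strictly_embeds (Restr r T) r"
    using untranscendable_any_type[OF u LA LT] prod by blast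
  then have "order_embeds r (Restr r T)"
    unfolding strictly_embeds_def using order_embeds_Restr[OF r T] by blast
  then obtain g where g0: "\<forall>x\<in>Field r. g x \<in> Field (Restr r T)"
    "\<forall>x y. (x, y) \<in> r \<longrightarrow> (g x, g y) \<in> Restr r T"
    "\<forall>x y. (x, y) \<in> r \<longrightarrow> x \<noteq> y \<longrightarrow> g x \<noteq> g y"
    by (rule order_embedsE_strict_mono)
  note g = g0[rule_format]
  have sep: "\<exists>b\<in>Field r - A. (g x, b) \<in> r \<and> (b, g y) \<in> r"
    if xy: "(x, y) \<in> r" "x \<noteq> y" for x y
  proof -
    from xy have F: "g x \<in> T" "g y \<in> T" "(g x, g y) \<in> r" using g(2) by auto
    then have c: "c (g x) = g x" "c (g y) = g y" unfolding T_def using idem by auto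
    show ?thesis
    proof (rule ccontr)
      assume no: "\<not> ?thesis"
      \<comment> \<open>Without a separating point, \<open>g x\<close> and \<open>g y\<close> lie in
        one component of \<open>A\<close>. Both are fixed by \<open>c\<close>, so they would
        coincide.\<close>
      have "between r (g x) (g y) \<subseteq> A"
      proof
        fix z assume "z \<in> between r (g x) (g y)"
        then have "(g x, z) \<in> r" "(z, g y) \<in> r" unfolding between_def using R(3,4) F by blast+
        then show "z \<in> A" using no by (blast intro: FieldI2)
      qed
      then have "g y \<in> comp (g x)" "g x \<in> A"
        using F T between_self_mem[OF r, of "g x" "g y"] unfolding comp_def by auto
      then have "c (g x) = c (g y)" using c_eq F T by blast
      then show False using c g(3)[OF xy] by simp
    qed
  qed
  show thesis
  proof (rule that[of g])
    show "\<forall>x y. (x, y) \<in> r \<longrightarrow> x \<noteq> y \<longrightarrow> (\<exists>b\<in>Field r - A. (g x, b) \<in> r \<and> (b, g y) \<in> r)"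
      using sep by blast
  qed (use g FT T in auto)
qed

text \<open>Otherwise some self-embedding \<open>g\<close> has a point of the finite set
  \<open>U\<close> between any two of its values. Then the positions of the values relative to
  \<open>U\<close> are pairwise distinct, while only finitely many positions exist.\<close>

lemma infinite_untranscendable_embeds_cofinite:
  assumes r: "Linear_order r" and u: "untranscendable r" and i: "infinite (Field r)"
    and U: "finite U" "U \<subseteq> Field r"
  shows "order_embeds r (Restr r (Field r - U))"
proof (rule ccontr)
  note R = Linear_orderD[OF r]
  assume n: "\<not> ?thesis"
  obtain g where g0: "\<forall>x\<in>Field r. g x \<in> Field r"
    "\<forall>x y. (x, y) \<in> r \<longrightarrow> (g x, g y) \<in> r"
    "\<forall>x y. (x, y) \<in> r \<longrightarrow> x \<noteq> y \<longrightarrow> g x \<noteq> g y"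
    "\<forall>x y. (x, y) \<in> r \<longrightarrow> x \<noteq> y \<longrightarrow> (\<exists>b\<in>Field r - (Field r - U). (g x, b) \<in> r \<and> (b, g y) \<in> r)"
    by (rule untranscendable_separated_self_embedding[OF r u _ n]) blast
  note g = g0[rule_format]
  \<comment> \<open>Both cuts are recorded because the separating point \<open>b\<close> may be an
    endpoint: if \<open>g x < b\<close> the first cut tells \<open>x\<close> from \<open>y\<close>,
    and if \<open>b = g x\<close> the second one does.\<close>
  define k where "k x = ({b \<in> U. (b, g x) \<in> r}, {b \<in> U. (b, g x) \<in> r \<and> b \<noteq> g x})" for x
  have "k x \<noteq> k y" if xy: "(x, y) \<in> r" "x \<noteq> y" for x y
  proof
    assume "k x = k y"
    then have k: "{b \<in> U. (b, g x) \<in> r} = {b \<in> U. (b, g y) \<in> r}"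
      "{b \<in> U. (b, g x) \<in> r \<and> b \<noteq> g x} = {b \<in> U. (b, g y) \<in> r \<and> b \<noteq> g y}"
      unfolding k_def by (simp_all only: prod.inject)
    obtain b where b: "b \<in> U" "(g x, b) \<in> r" "(b, g y) \<in> r" using g(4)[OF xy] by blast
    then have "(b, g x) \<in> r" using k(1) by blast
    then have "b = g x" using b R(4) by blast
    moreover have "b \<noteq> g y" using g(3)[OF xy] \<open>b = g x\<close> by simp
    ultimately show False using b k(2) by blast
  qed
  then have "inj_on k (Field r)" by (intro inj_onI) (metis R(5))
  moreover have "k ` Field r \<subseteq> Pow U \<times> Pow U" unfolding k_def by blast
  then have "finite (k ` Field r)" by (rule finite_subset) (simp add: U(1))
  ultimately show False using i finite_imageD by blast
qed

section \<open>Finite linear orders\<close>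

text \<open>Counting strict predecessors is strictly monotone with values below the cardinality,
  hence onto by finiteness.\<close>

lemma finite_Linear_order_isomorphic_natLeq_on:
  assumes r: "Linear_order r" and f: "finite (Field r)"
  shows "order_isomorphic r (natLeq_on (card (Field r)))"
proof -
  note R = Linear_orderD[OF r]
  define k where "k x = card {y. (y, x) \<in> r \<and> y \<noteq> x}" for x
  have sub: "{y. (y, x) \<in> r \<and> y \<noteq> x} \<subseteq> Field r" for x by (auto intro: FieldI1)
  have m: "k x < k y" if "(x, y) \<in> r" "x \<noteq> y" for x y
    unfolding k_def using that R(3,4)
    by (intro psubset_card_mono finite_subset[OF sub f]) blast
  have less: "k x < card (Field r)" if "x \<in> Field r" for x
    unfolding k_def using that sub[of x] by (intro psubset_card_mono f) blast
  have inj: "inj_on k (Field r)" by (rule inj_onI) (metis m R(5) less_irrefl)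
  have "k ` Field r = {x. x < card (Field r)}"
    by (rule card_subset_eq) (use less in \<open>auto simp: card_image[OF inj]\<close>)
  moreover have "(x, y) \<in> r \<longleftrightarrow> (k x, k y) \<in> natLeq_on (card (Field r))"
    if "x \<in> Field r" "y \<in> Field r" for x y
    using less that m R(2,5) by (auto simp: le_less) (metis less_asym)+
  ultimately show ?thesis
    unfolding order_isomorphic_def bij_betw_def Field_natLeq_on using inj by blast
qed

lemma order_isomorphic_imp_embeds:
  assumes "order_isomorphic r s"
  shows "order_embeds s r"
proof -
  obtain f where f: "bij_betw f (Field r) (Field s)"
    "\<And>x y. x \<in> Field r \<Longrightarrow> y \<in> Field r \<Longrightarrow> (x, y) \<in> r \<longleftrightarrow> (f x, f y) \<in> s"
    using assms unfolding order_isomorphic_def by blast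
  let ?h = "inv_into (Field r) f"
  have h: "bij_betw ?h (Field s) (Field r)" using f(1) by (rule bij_betw_inv_into)
  have "(x, y) \<in> s \<longleftrightarrow> (?h x, ?h y) \<in> r" if "x \<in> Field s" "y \<in> Field s" for x y
    using f(2)[of "?h x" "?h y"] that bij_betwE[OF h] bij_betw_inv_into_right[OF f(1)] by simp
  then show ?thesis
    unfolding order_embeds_def using h by (intro exI[of _ ?h]) (simp add: bij_betw_def)
qed

text \<open>Any \<open>n\<close> points of \<open>r\<close> form a copy of
  \<open>natLeq_on n\<close>. With \<open>n = 3\<close> this makes the order of the fibres an
  admissible factor for untranscendability.\<close>

lemma natLeq_on_strictly_embeds_infinite:
  assumes r: "Linear_order r" and i: "infinite (Field r)"
  shows "strictly_embeds (natLeq_on n) r"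
proof -
  obtain T where T: "finite T" "card T = n" "T \<subseteq> Field r"
    using infinite_arbitrarily_large[OF i] by metis
  have F: "Field (Restr r T) = T" using Field_Restr_Linear_order[OF r T(3)] .
  have "order_embeds (natLeq_on n) (Restr r T)"
    using finite_Linear_order_isomorphic_natLeq_on[OF Linear_order_Restr[OF r], of T] T F
    by (auto intro: order_isomorphic_imp_embeds)
  then have "order_embeds (natLeq_on n) r"
    using order_embeds_Restr[OF r T(3)] order_embeds_trans by blast
  moreover have "\<not> order_embeds r (natLeq_on n)"
    using order_embeds_finite[of r "natLeq_on n"] i by (auto simp: Field_natLeq_on)
  ultimately show ?thesis unfolding strictly_embeds_def by blast
qed

section \<open>The infinite case\<close>

text \<open>The two failures of embedding enter at different places: the one for \<open>A\<close>
  yields \<open>g\<close>, the one for \<open>B\<close> says that \<open>B\<close> is strictly below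
  \<open>s\<close>, which the embedding into \<open>3\<close> times \<open>B\<close> finally
  contradicts.\<close>

lemma infinite_untranscendable_strongly_indecomposable:
  assumes s: "Linear_order s" and u: "untranscendable s" and i: "infinite (Field s)"
    and F: "finitely_many_finite_F_classes s"
  shows "strongly_indecomposable s"
  unfolding strongly_indecomposable_def
proof (intro allI impI)
  fix A B assume AB: "A \<union> B = Field s \<and> A \<inter> B = {}"
  note S = Linear_orderD[OF s]
  show "order_embeds s (Restr s A) \<or> order_embeds s (Restr s B)"
  proof (rule ccontr)
    assume neg: "\<not> ?thesis"
    have A: "A \<subseteq> Field s" and B: "B = Field s - A" using AB by auto
    obtain g where g0: "\<forall>x\<in>Field s. g x \<in> Field s"
      "\<forall>x y. (x, y) \<in> s \<longrightarrow> (g x, g y) \<in> s"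
      "\<forall>x y. (x, y) \<in> s \<longrightarrow> x \<noteq> y \<longrightarrow> g x \<noteq> g y"
      "\<forall>x y. (x, y) \<in> s \<longrightarrow> x \<noteq> y \<longrightarrow> (\<exists>b\<in>B. (g x, b) \<in> s \<and> (b, g y) \<in> s)"
      by (rule untranscendable_separated_self_embedding[OF s u A, folded B]) (use neg in blast)
    note g = g0[rule_format]
    define U where "U = {x \<in> Field s. finite (finite_condensation s `` {x})}"
    have "between s x x \<subseteq> {x}" for x unfolding between_def using S(4) by auto
    then have "x \<in> finite_condensation s `` {x}" if "x \<in> Field s" for x
      using that finite_subset[of "between s x x" "{x}"] unfolding finite_condensation_def by auto
    then have "U \<subseteq> \<Union>{C \<in> F_classes s. finite C}"
      unfolding U_def F_classes_def by (auto simp: quotient_def)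
    moreover have "finite (\<Union>{C \<in> F_classes s. finite C})"
      using F unfolding finitely_many_finite_F_classes_def by (intro finite_Union) auto
    ultimately have "finite U" by (rule finite_subset)
    define Y where "Y = Field s - U"
    have sY: "order_embeds s (Restr s Y)"
      unfolding Y_def
      by (rule infinite_untranscendable_embeds_cofinite[OF s u i \<open>finite U\<close>]) (auto simp: U_def)
    have YF: "Y \<subseteq> Field s" unfolding Y_def by blast
    \<comment> \<open>The class of \<open>y\<close> is infinite and stays inside \<open>Y\<close>,
      so \<open>y\<close> has other points of \<open>Y\<close> at finite distance, and a nearest one
      is a neighbour of \<open>y\<close> in \<open>Y\<close>. Whether it lies above or below
      \<open>y\<close> decides which of \<open>l\<close>, \<open>h\<close> is
      \<open>y\<close>.\<close>
    have "\<exists>l h. l \<in> Y \<and> h \<in> Y \<and> (l, h) \<in> s \<and> l \<noteq> h \<and> y \<in> {l, h} \<and>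
        (\<forall>z\<in>Y. (l, z) \<in> s \<longrightarrow> (z, h) \<in> s \<longrightarrow> z \<in> {l, h})" if y: "y \<in> Y" for y
    proof -
      have yF: "y \<in> Field s" using y YF by blast
      let ?C = "finite_condensation s `` {y}"
      have inf: "infinite ?C" using y unfolding Y_def U_def by blast
      have CY: "z \<in> Y" if z: "z \<in> ?C" for z
      proof -
        have zF: "z \<in> Field s" using z unfolding finite_condensation_def by auto
        have "?C \<subseteq> finite_condensation s `` {z}"
        proof
          fix w assume w: "w \<in> ?C"
          have "between s z w \<subseteq> between s y z \<union> between s y w"
            using between_subset_Un[OF s yF, of z w] by (simp add: between_commute)
          then show "w \<in> finite_condensation s `` {z}"
            using z w unfolding finite_condensation_def by (auto intro: finite_subset)
        qed
        then have "infinite (finite_condensation s `` {z})" using inf finite_subset by blast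
        then show ?thesis unfolding Y_def U_def using zF by blast
      qed
      let ?P = "\<lambda>z. z \<in> Y \<and> z \<noteq> y \<and> finite (between s y z)"
      have "infinite (?C - {y})" using inf by simp
      then obtain x where "x \<in> ?C - {y}" by (metis ex_in_conv finite.emptyI)
      then have "?P x" using CY by (auto simp: finite_condensation_def)
      then obtain z where z: "?P z" and least: "\<And>w. ?P w \<Longrightarrow> card (between s y z) \<le> card (between s y w)"
        using ex_has_least_nat[of ?P x "\<lambda>z. card (between s y z)"] by blast
      have zF: "z \<in> Field s" using z YF by blast
      \<comment> \<open>A point of \<open>Y\<close> strictly between would span with
        \<open>y\<close> a properly smaller finite interval, against the choice of
        \<open>z\<close>.\<close>
      have gap: "w \<in> {y, z}" if w: "w \<in> Y" "w \<in> between s y z" for w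
      proof (rule ccontr)
        assume n: "w \<notin> {y, z}"
        have "between s y w \<subseteq> between s y z" "z \<notin> between s y w"
          using w(2) n S(3,4) unfolding between_def by blast+
        then have "between s y w \<subset> between s y z" using between_self_mem[OF s yF zF] by blast
        then have "card (between s y w) < card (between s y z)" "finite (between s y w)"
          using z by (auto intro: psubset_card_mono finite_subset)
        then show False using least[of w] n w by simp
      qed
      show ?thesis
      proof (cases "(y, z) \<in> s")
        case True
        have "w \<in> {y, z}" if "w \<in> Y" "(y, w) \<in> s" "(w, z) \<in> s" for w
          using gap[OF that(1)] that(2,3) unfolding between_def by blast
        then show ?thesis using True y z by (rule_tac exI[where x = y], rule_tac exI[where x = z]) blast
      next
        case False
        then have "(z, y) \<in> s" using S(5) yF zF by blast
        moreover have "w \<in> {z, y}" if "w \<in> Y" "(z, w) \<in> s" "(w, y) \<in> s" for w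
          using gap[OF that(1)] that(2,3) unfolding between_def by blast
        ultimately show ?thesis using y z by (rule_tac exI[where x = z], rule_tac exI[where x = y]) blast
      qed
    qed
    then obtain l h where lh: "\<And>y. y \<in> Y \<Longrightarrow> l y \<in> Y \<and> h y \<in> Y \<and> (l y, h y) \<in> s \<and> l y \<noteq> h y \<and> y \<in> {l y, h y}"
      and gap: "\<And>y z. y \<in> Y \<Longrightarrow> z \<in> Y \<Longrightarrow> (l y, z) \<in> s \<Longrightarrow> (z, h y) \<in> s \<Longrightarrow> z \<in> {l y, h y}"
      by metis
    obtain b where b: "\<And>x y. (x, y) \<in> s \<Longrightarrow> x \<noteq> y \<Longrightarrow>
        b x y \<in> B \<and> (g x, b x y) \<in> s \<and> (b x y, g y) \<in> s"
      using g(4) by metis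
    define c where "c y = b (l y) (h y)" for y
    have c: "c y \<in> B" "(g (l y), c y) \<in> s" "(c y, g (h y)) \<in> s" if "y \<in> Y" for y
      using b lh[OF that] unfolding c_def by blast+
    \<comment> \<open>As \<open>l y\<close> and \<open>h y\<close> are consecutive in
      \<open>Y\<close>, everything in \<open>Y\<close> strictly above \<open>y\<close> is at least
      \<open>h y\<close>, whichever of the two \<open>y\<close> is. Dually for
      \<open>l z\<close>.\<close>
    have hz: "(h y, z) \<in> s" and yl: "(y, l z) \<in> s"
      if yz: "y \<in> Y" "z \<in> Y" "(y, z) \<in> s" "y \<noteq> z" for y z
    proof -
      have F: "h y \<in> Field s" "l z \<in> Field s" "y \<in> Field s" "z \<in> Field s"
        using lh yz YF by blast+
      show "(h y, z) \<in> s"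
      proof (rule ccontr)
        assume n: "(h y, z) \<notin> s"
        then have "(z, h y) \<in> s" "z \<noteq> h y" using S(2,5) F by blast+
        moreover have "(l y, z) \<in> s" using lh[OF yz(1)] yz(3) n by (metis insertE singletonD)
        ultimately have "z = l y" using gap[OF yz(1,2)] by blast
        then show False using yz(3,4) lh[OF yz(1)] n by (metis insertE singletonD)
      qed
      show "(y, l z) \<in> s"
      proof (rule ccontr)
        assume n: "(y, l z) \<notin> s"
        then have "(l z, y) \<in> s" "y \<noteq> l z" using S(2,5) F by blast+
        moreover have "(y, h z) \<in> s" using lh[OF yz(2)] yz(3) n by (metis insertE singletonD)
        ultimately have "y = h z" using gap[OF yz(2,1)] by blast
        then show False using yz(3,4) lh[OF yz(2)] n by (metis insertE singletonD)
      qed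
    qed
    have mono: "(c y, c z) \<in> s" if yz: "y \<in> Y" "z \<in> Y" "(y, z) \<in> s" for y z
    proof (cases "y = z \<or> (l y = l z \<and> h y = h z)")
      case True
      then have "c y = c z" unfolding c_def by auto
      then show ?thesis using c(1)[OF yz(1)] B S(2) by simp
    next
      case False
      note D = lh[OF yz(1)] lh[OF yz(2)]
      \<comment> \<open>Distinct pairs do not overlap: if \<open>l z < h y\<close>, then
        \<open>y = l y\<close> and \<open>z = h z\<close>, and consecutiveness forces
        \<open>l z = l y\<close> and \<open>h y = h z\<close>. Hence \<open>c y\<close> is at most
        \<open>g (h y)\<close>, which is at most \<open>g (l z)\<close>, which is at most
        \<open>c z\<close>.\<close>
      have "(h y, l z) \<in> s"
      proof (rule ccontr)
        assume n: "(h y, l z) \<notin> s"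
        have ne: "y \<noteq> z" using False by blast
        have "y = l y" using yl[OF yz ne] D n by auto
        moreover have "z = h z" using hz[OF yz ne] D n by auto
        moreover have "(l z, h y) \<in> s" using n S(5) D YF by blast
        ultimately have "l z \<in> {l y, h y}" using gap[OF yz(1), of "l z"] yl[OF yz ne] D by metis
        then have "l z = l y" using n S(2) D YF by auto
        moreover have "h y \<in> {l z, h z}"
          using gap[OF yz(2), of "h y"] hz[OF yz ne] \<open>z = h z\<close> \<open>(l z, h y) \<in> s\<close> D by metis
        ultimately show False using False D by auto
      qed
      then have "(g (h y), g (l z)) \<in> s" using g(2) by blast
      then show ?thesis using c(3)[OF yz(1)] c(2)[OF yz(2)] S(3) by blast
    qed
    have LY: "Linear_order (Restr s Y)" and LB: "Linear_order (Restr s B)"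
      using s Linear_order_Restr by blast+
    have FY: "Field (Restr s Y) = Y" and FB: "Field (Restr s B) = B"
      using Field_Restr_Linear_order[OF s] YF B by blast+
    have L3: "Linear_order (natLeq_on 3)" using natLeq_on_Well_order[of 3] unfolding well_order_on_def by blast
    have "order_embeds (Restr s Y) (antilex_prod (natLeq_on 3) (Restr s B))"
    proof (rule order_embeds_antilex_prod[where c = c, OF LY L3 LB])
      fix v assume "v \<in> Field (Restr s B)"
      \<comment> \<open>For \<open>y < z\<close> in the fibre over \<open>v\<close>, the bounds
        through \<open>l z\<close> and \<open>h y\<close> place \<open>v\<close> between
        \<open>g y\<close> and \<open>g z\<close>. The position of \<open>g y\<close> relative to
        \<open>v\<close>, coded by \<open>0\<close>, \<open>1\<close>, \<open>2\<close> for below,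
        equal and above, therefore increases strictly along the fibre.\<close>
      define k :: "'a \<Rightarrow> nat" where
        "k y = (if g y = v then 1 else if (g y, v) \<in> s then 0 else 2)" for y
      have "(k y, k z) \<in> natLeq_on 3 \<and> k y \<noteq> k z"
        if yz: "(y, z) \<in> Restr s Y" "y \<noteq> z" "c y = v" "c z = v" for y z
      proof -
        have Y: "y \<in> Y" "z \<in> Y" "(y, z) \<in> s" using yz(1) by auto
        have "(v, g z) \<in> s" using c(3)[OF Y(1)] g(2)[OF hz[OF Y yz(2)]] S(3) yz(3) by blast
        moreover have "(g y, v) \<in> s" using c(2)[OF Y(2)] g(2)[OF yl[OF Y yz(2)]] S(3) yz(4) by blast
        moreover have "g y \<noteq> g z" using g(3) Y(3) yz(2) by blast
        ultimately show ?thesis unfolding k_def using S(4) by auto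
      qed
      then show "\<exists>k. (\<forall>y\<in>Field (Restr s Y). c y = v \<longrightarrow> k y \<in> Field (natLeq_on 3)) \<and>
          (\<forall>y z. (y, z) \<in> Restr s Y \<longrightarrow> y \<noteq> z \<longrightarrow> c y = v \<longrightarrow> c z = v \<longrightarrow>
             (k y, k z) \<in> natLeq_on 3 \<and> k y \<noteq> k z)"
        by (intro exI[of _ k]) (auto simp: Field_natLeq_on k_def)
    qed (use c(1) FY FB mono in auto)
    then have "order_embeds s (antilex_prod (natLeq_on 3) (Restr s B))"
      using sY order_embeds_trans by blast
    moreover have "strictly_embeds (Restr s B) s"
      unfolding strictly_embeds_def using neg order_embeds_Restr[OF s, of B] B by blast
    ultimately show False
      using untranscendable_any_type[OF u L3 LB natLeq_on_strictly_embeds_infinite[OF s i]] by blast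
  qed
qed

section \<open>The finite case\<close>

text \<open>Remove the least of at least three points \<open>e 0 < e 1 < e 2\<close>. By counting,
  \<open>r\<close> does not embed in the rest, so a self-embedding \<open>g\<close> has
  \<open>e 0\<close> between any two of its values. Then \<open>g (e 1)\<close> is at most
  \<open>e 0\<close>, and \<open>g\<close> takes the value \<open>e 0\<close> at both
  \<open>e 0\<close> and \<open>e 1\<close>.\<close>

lemma finite_untranscendable_card_le:
  assumes r: "Linear_order r" and u: "untranscendable r" and f: "finite (Field r)"
  shows "card (Field r) \<le> 2"
proof (rule ccontr)
  assume "\<not> ?thesis"
  then have n2: "2 < card (Field r)" by simp
  note R = Linear_orderD[OF r]
  have "order_embeds (natLeq_on (card (Field r))) r"
    by (rule order_isomorphic_imp_embeds[OF finite_Linear_order_isomorphic_natLeq_on[OF r f]])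
  then obtain e where e0: "\<forall>i\<in>Field (natLeq_on (card (Field r))). e i \<in> Field r"
    "\<forall>i j. (i, j) \<in> natLeq_on (card (Field r)) \<longrightarrow> (e i, e j) \<in> r"
    "\<forall>i j. (i, j) \<in> natLeq_on (card (Field r)) \<longrightarrow> i \<noteq> j \<longrightarrow> e i \<noteq> e j"
    by (rule order_embedsE_strict_mono)
  have e: "i < card (Field r) \<Longrightarrow> e i \<in> Field r"
    "i \<le> j \<Longrightarrow> j < card (Field r) \<Longrightarrow> (e i, e j) \<in> r"
    "i < j \<Longrightarrow> j < card (Field r) \<Longrightarrow> e i \<noteq> e j" for i j
    using e0 by (simp_all add: Field_natLeq_on)
  have inj: "inj_on e {..<card (Field r)}"
    by (rule inj_onI) (metis e(3) lessThan_iff linorder_neqE)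
  then have surj: "e ` {..<card (Field r)} = Field r"
    by (intro card_subset_eq f image_subsetI) (use e(1) in \<open>simp_all add: card_image\<close>)
  have e_0: "e 0 \<in> Field r" using e(1) n2 by simp
  let ?A = "Field r - {e 0}"
  have n: "\<not> order_embeds r (Restr r ?A)"
  proof
    assume "order_embeds r (Restr r ?A)"
    then have "card (Field r) \<le> card ?A"
      unfolding order_embeds_def using Field_Restr_Linear_order[OF r, of ?A] f
      by (metis Diff_subset card_inj_on_le finite_Diff)
    then show False using card_Diff1_less[OF f e_0] by simp
  qed
  obtain g where g0: "\<forall>x\<in>Field r. g x \<in> Field r"
    "\<forall>x y. (x, y) \<in> r \<longrightarrow> (g x, g y) \<in> r"
    "\<forall>x y. (x, y) \<in> r \<longrightarrow> x \<noteq> y \<longrightarrow> g x \<noteq> g y"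
    "\<forall>x y. (x, y) \<in> r \<longrightarrow> x \<noteq> y \<longrightarrow> (\<exists>b\<in>Field r - ?A. (g x, b) \<in> r \<and> (b, g y) \<in> r)"
    by (rule untranscendable_separated_self_embedding[OF r u _ n]) blast
  note g = g0[rule_format]
  have "\<forall>x\<in>e ` {..<card (Field r)}. (e 0, x) \<in> r" using e(2)[of 0] by auto
  then have min: "(e 0, x) \<in> r" if "x \<in> Field r" for x using that unfolding surj by blast
  have 1: "(e 0, e 1) \<in> r" "e 0 \<noteq> e 1" and 2: "(e 1, e 2) \<in> r" "e 1 \<noteq> e 2"
    using n2 by (intro e; simp)+
  have g1: "(g (e 1), e 0) \<in> r" using g(4)[OF 2] by blast
  then have g0: "(g (e 0), e 0) \<in> r" using R(3)[OF g(2)[OF 1(1)]] by blast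
  have "g (e 0) = e 0" "g (e 1) = e 0"
    using R(4)[OF g0 min] R(4)[OF g1 min] g(1) e(1) n2 by simp_all
  then show False using g(3)[OF 1] by simp
qed

section \<open>Invariance under equimorphism and the conclusion\<close>

text \<open>A partition of \<open>r\<close> is pulled back along the embedding \<open>g\<close> of
  \<open>s\<close> into \<open>r\<close>. One pulled-back part contains a copy of \<open>s\<close>,
  hence of \<open>r\<close>, and \<open>g\<close> carries it into the corresponding part of
  \<open>r\<close>.\<close>

lemma strongly_indecomposable_equimorphic:
  assumes r: "Linear_order r" and s: "Linear_order s" and e: "equimorphic r s"
    and i: "strongly_indecomposable s"
  shows "strongly_indecomposable r"
  unfolding strongly_indecomposable_def
proof (intro allI impI)
  fix A B assume AB: "A \<union> B = Field r \<and> A \<inter> B = {}"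
  have "order_embeds s r" using e unfolding equimorphic_def by simp
  then obtain g where g0: "\<forall>x\<in>Field s. g x \<in> Field r" "\<forall>x y. (x, y) \<in> s \<longrightarrow> (g x, g y) \<in> r"
    "\<forall>x y. (x, y) \<in> s \<longrightarrow> x \<noteq> y \<longrightarrow> g x \<noteq> g y"
    by (rule order_embedsE_strict_mono)
  note g = g0[rule_format]
  let ?p = "\<lambda>C. {x \<in> Field s. g x \<in> C}"
  have emb: "order_embeds (Restr s (?p C)) (Restr r C)" if "C \<subseteq> Field r" for C
  proof (rule order_embeds_strict_monoI[where f = g])
    show "Linear_order (Restr s (?p C))" "Linear_order (Restr r C)"
      using r s by (blast intro: Linear_order_Restr)+
    have p: "?p C \<subseteq> Field s" by blast
    show "g x \<in> Field (Restr r C)" if "x \<in> Field (Restr s (?p C))" for x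
      using that unfolding Field_Restr_Linear_order[OF r \<open>C \<subseteq> Field r\<close>]
        Field_Restr_Linear_order[OF s p] by blast
    show "(g x, g y) \<in> Restr r C \<and> g x \<noteq> g y"
      if "(x, y) \<in> Restr s (?p C)" "x \<noteq> y" for x y
      using that g(2)[of x y] g(3)[of x y] by simp
  qed
  have "?p A \<union> ?p B = Field s \<and> ?p A \<inter> ?p B = {}" using AB g(1) by blast
  then have "order_embeds s (Restr s (?p A)) \<or> order_embeds s (Restr s (?p B))"
    by (rule i[unfolded strongly_indecomposable_def, rule_format])
  moreover have "order_embeds r s" using e unfolding equimorphic_def by simp
  note order_embeds_trans[OF order_embeds_trans[OF this] emb]
  moreover have "A \<subseteq> Field r" "B \<subseteq> Field r" using AB by blast+
  ultimately show "order_embeds r (Restr r A) \<or> order_embeds r (Restr r B)" by blast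
qed

text \<open>Factors that refute the property for \<open>s\<close> refute it for \<open>r\<close>;
  they live on the type of \<open>s\<close>, whence \<open>untranscendable_any_type\<close>.\<close>

lemma untranscendable_equimorphic:
  assumes u: "untranscendable r" and e: "equimorphic r s"
  shows "untranscendable s"
  unfolding untranscendable_def
proof clarify
  fix p t assume pt: "Linear_order p" "Linear_order t" "strictly_embeds p s" "strictly_embeds t s"
    "order_embeds s (antilex_prod p t)"
  have "strictly_embeds p r" "strictly_embeds t r" "order_embeds r (antilex_prod p t)"
    using pt e unfolding strictly_embeds_def equimorphic_def by (meson order_embeds_trans)+
  then show False using untranscendable_any_type[OF u pt(1,2)] by blast
qed

theorem theorem5p9:
  fixes r :: "'a rel" and s :: "'b rel"
  assumes "Linear_order r" and "untranscendable r"
    and "Linear_order s" and "equimorphic r s" and "finitely_many_finite_F_classes s"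
  shows "strongly_indecomposable r \<or> order_isomorphic r (natLeq_on 2)"
proof (cases "finite (Field r)")
  case False
  then have "infinite (Field s)"
    using assms(4) order_embeds_finite unfolding equimorphic_def by blast
  then have "strongly_indecomposable s"
    using infinite_untranscendable_strongly_indecomposable assms untranscendable_equimorphic by blast
  then show ?thesis using strongly_indecomposable_equimorphic assms by blast
next
  case True
  show ?thesis
  proof (cases "card (Field r) = 2")
    case True
    then show ?thesis
      using finite_Linear_order_isomorphic_natLeq_on[OF assms(1)] \<open>finite (Field r)\<close> by auto
  next
    case False
    then have "card (Field r) \<le> 1"
      using finite_untranscendable_card_le[OF assms(1,2) True] by simp
    \<comment> \<open>With at most one point, one part of a partition is empty and the other is the
      whole order.\<close>
    have "A = {} \<or> B = {}" if "A \<union> B = Field r \<and> A \<inter> B = {}" for A B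
    proof (rule ccontr)
      assume "\<not> ?thesis"
      then obtain a b where "a \<in> A" "b \<in> B" by blast
      then have "{a, b} \<subseteq> Field r" "a \<noteq> b" using that by auto
      then show False using card_mono[OF True, of "{a, b}"] \<open>card (Field r) \<le> 1\<close> by simp
    qed
    moreover have "order_embeds r (Restr r (Field r))"
      by (rule order_embeds_strict_monoI[where f = "\<lambda>x. x"])
        (use assms(1) in \<open>auto simp: linear_order_on_Restr Field_Restr_Linear_order
           intro: FieldI1 FieldI2\<close>)
    ultimately have "strongly_indecomposable r"
      unfolding strongly_indecomposable_def by (metis sup_bot.left_neutral sup_bot.right_neutral)
    then show ?thesis by blast
  qed
qed

end
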